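(* Let $b\ge 1$ be an integer, let $q:\{0,1,\dots,b\}\to\mathbb{R}$, let $h\in\mathbb{R}$, and let $\lambda\in\mathbb{C}$ with $\lambda(\lambda-4)\neq 0$. Fix a square root $\sqrt{\lambda(\lambda-4)}$ of $\lambda(\lambda-4)$, the same one throughout. Then the problem $$\Delta^2 x(n-1)+q(n)x(n)=-\lambda x(n),\qquad n=0,1,\dots,b,$$ $$x(0)=-h,\qquad x(1)=1,$$ has a unique solution $x(\cdot)=x(\cdot,\lambda):\{-1,0,\dots,b+1\}\to\mathbb{C}$, and for every $n\in\{-1,0,\dots,b\}$ this solution satisfies $$\begin{aligned} x(n,\lambda)={}&\left(\frac{2-h\left(2q(0)-2+\lambda+\sqrt{\lambda(\lambda-4)}\right)}{2\sqrt{\lambda(\lambda-4)}}\right)\left(\frac{2-\lambda+\sqrt{\lambda(\lambda-4)}}{2}\right)^{n}\\ &+\left(\frac{-2+h\left(2q(0)-2+\lambda-\sqrt{\lambda(\lambda-4)}\right)}{2\sqrt{\lambda(\lambda-4)}}\right)\left(\frac{2-\lambda-\sqrt{\lambda(\lambda-4)}}{2}\right)^{n}\\ &-\sum_{i=0}^{n}\frac{q(i)x(i)\left(\frac{2-\lambda-\sqrt{\lambda(\lambda-4)}}{2}\right)^{i}}{\sqrt{\lambda(\lambda-4)}}\left(\frac{2-\lambda+\sqrt{\lambda(\lambda-4)}}{2}\right)^{n}\\ &+\sum_{i=0}^{n}\frac{q(i)x(i)\left(\frac{2-\lambda+\sqrt{\lambda(\lambda-4)}}{2}\right)^{i}}{\sqrt{\lambda(\lambda-4)}}\left(\frac{2-\lambda-\sqrt{\lambda(\lambda-4)}}{2}\right)^{n},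 \end{aligned}$$ where $\sum_{i=0}^{-1}(\cdot)=0$.
   Context: $\Delta$ is the forward difference operator, $\Delta x(n)=x(n+1)-x(n)$, so $\Delta^2x(n-1)=x(n+1)-2x(n)+x(n-1)$. The function $q$ is the potential and $\lambda$ is the spectral parameter. The displayed representation is an implicit (summation-equation) formula: the values $x(i)=x(i,\lambda)$ of the solution itself occur in the sums on the right-hand side. *)

theory Defs
  imports Complex_Main "HOL-Library.FuncSet"
begin

definition fwd_diff :: "(int \<Rightarrow> 'a::ab_group_add) \<Rightarrow> int \<Rightarrow> 'a" where
  "fwd_diff x n = x (n + 1) - x n"

(* A function on the discrete interval {-1..b+1} is an element of the extensional
   function space, so that equality of solutions is equality on the interval.
   Only the values of the potential q on {0..b} are used. *)
definition ivp_solution ::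
  "int \<Rightarrow> (int \<Rightarrow> real) \<Rightarrow> real \<Rightarrow> complex \<Rightarrow> (int \<Rightarrow> complex) \<Rightarrow> bool" where
  "ivp_solution b q h lam x \<longleftrightarrow>
     x \<in> {-1..b+1} \<rightarrow>\<^sub>E UNIV \<and>
     (\<forall>n\<in>{0..b}. (fwd_diff ^^ 2) x (n - 1) + of_real (q n) * x n = - lam * x n) \<and>
     x 0 = - of_real h \<and> x 1 = 1"

end

theory Submission
  imports Defs
begin

text \<open>
  The equation is the three-term recurrence
  \<open>x (n + 1) - (2 - \<lambda>) x n + x (n - 1) = - q n x n\<close>. It can be run forwards from \<open>x 0\<close> and
  \<open>x 1\<close>, and one step backwards to \<open>x (-1)\<close>, whence existence and uniqueness.

  For the representation, put \<open>p = (2 - \<lambda> + s) / 2\<close> and \<open>m = (2 - \<lambda> - s) / 2\<close>. Then \<open>p + m = 2 - \<lambda>\<close>,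
  \<open>p m = 1\<close> and \<open>p - m = s\<close>: these are the roots of the characteristic polynomial of the free
  equation. The second-order operator factors through them, so that \<open>x (n + 1) - m x n\<close> obeys a
  first-order recurrence with multiplier \<open>p\<close>, and \<open>x (n + 1) - p x n\<close> one with multiplier \<open>m\<close>.
  Multiplying by \<open>m ^ n\<close> and \<open>p ^ n\<close> respectively turns both into telescoping sums
  (\<open>factored_recurrence_telescopes\<close>). The difference of the two first-order quantities is
  \<open>(p - m) x n = s x n\<close>, and since \<open>s \<noteq> 0\<close> this can be solved for \<open>x n\<close>.
\<close>

lemma ivp_solution_iff_recurrence:
  "ivp_solution b q h lam x \<longleftrightarrow>
     x \<in> {-1..b+1} \<rightarrow>\<^sub>E UNIV \<and>
     (\<forall>n\<in>{0..b}. x (n + 1) - (2 - lam) * x n + x (n - 1) = - (of_real (q n) * x n)) \<and>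
     x 0 = - of_real h \<and> x 1 = 1"
proof -
  have "(fwd_diff ^^ 2) x (n - 1) + of_real (q n) * x n = - lam * x n \<longleftrightarrow>
        x (n + 1) - (2 - lam) * x n + x (n - 1) = - (of_real (q n) * x n)" for n
  proof -
    have "(fwd_diff ^^ 2) x (n - 1) = x (n + 1) - 2 * x n + x (n - 1)"
      by (simp add: numeral_2_eq_2 fwd_diff_def algebra_simps)
    moreover have "(u - 2 * v + w + k * v = - lam * v) \<longleftrightarrow> (u - (2 - lam) * v + w = - (k * v))"
      for u v w k :: complex
    proof -
      have "u - 2 * v + w + k * v - (- lam * v) = u - (2 - lam) * v + w - (- (k * v))"
        by (simp add: algebra_simps)
      then show ?thesis
        by (metis eq_iff_diff_eq_0)
    qed
    ultimately show ?thesis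
      by simp
  qed
  then show ?thesis
    unfolding ivp_solution_def by simp
qed

fun forward_solution :: "(int \<Rightarrow> 'a) \<Rightarrow> 'a \<Rightarrow> 'a \<Rightarrow> nat \<Rightarrow> 'a::comm_ring_1" where
  "forward_solution c x0 x1 0 = x0"
| "forward_solution c x0 x1 (Suc 0) = x1"
| "forward_solution c x0 x1 (Suc (Suc k)) =
     c (int k + 1) * forward_solution c x0 x1 (Suc k) - forward_solution c x0 x1 k"

lemma ivp_solution_exists:
  assumes "b \<ge> 0"
  shows "\<exists>x. ivp_solution b q h lam x"
proof -
  define c where "c n = 2 - lam - of_real (q n)" for n
  define z where "z = forward_solution c (- of_real h) 1"
  \<comment> \<open>The value at \<open>-1\<close> is dictated by the equation at \<open>n = 0\<close>.\<close>
  define x where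
    "x = restrict (\<lambda>n. if n = -1 then c 0 * z 0 - z 1 else z (nat n)) {-1..b+1}"
  have "x (n + 1) - (2 - lam) * x n + x (n - 1) = - (of_real (q n) * x n)"
    if n: "n \<in> {0..b}" for n
  proof (cases "n = 0")
    case True
    then show ?thesis
      using assms by (simp add: x_def c_def algebra_simps)
  next
    case False
    define k where "k = nat (n - 1)"
    have "n = int k + 1"
      using False n by (simp add: k_def)
    then show ?thesis
      using n by (simp add: x_def z_def c_def nat_add_distrib algebra_simps)
  qed
  moreover have "x 0 = - of_real h" "x 1 = 1"
    using assms by (simp_all add: x_def z_def)
  moreover have "x \<in> {-1..b+1} \<rightarrow>\<^sub>E UNIV"
    by (simp add: x_def)
  ultimately show ?thesis
    unfolding ivp_solution_iff_recurrence by blast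
qed

lemma ivp_solution_unique:
  assumes "b \<ge> 0"
    and x: "ivp_solution b q h lam x"
    and y: "ivp_solution b q h lam y"
  shows "x = y"
proof -
  have rec: "u (n + 1) = (2 - lam - of_real (q n)) * u n - u (n - 1)"
    if "ivp_solution b q h lam u" "n \<in> {0..b}" for u n
  proof -
    have "u (n + 1) - (2 - lam) * u n + u (n - 1) = - (of_real (q n) * u n)"
      using that by (simp add: ivp_solution_iff_recurrence)
    then show ?thesis
      by (simp add: algebra_simps add_eq_0_iff)
  qed
  have init: "x 0 = y 0" "x 1 = y 1"
    using x y by (simp_all add: ivp_solution_def)
  have forward: "n \<le> b \<longrightarrow> x n = y n \<and> x (n + 1) = y (n + 1)" if "0 \<le> n" for n
    using that
  proof (induction n rule: int_ge_induct)
    case base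
    show ?case
      using init by simp
  next
    case (step n)
    then show ?case
      using rec[OF x, of "n + 1"] rec[OF y, of "n + 1"] by auto
  qed
  have backward: "x (-1) = y (-1)"
    using rec[OF x, of 0] rec[OF y, of 0] init \<open>b \<ge> 0\<close> by simp
  show ?thesis
  proof (rule PiE_ext)
    show "x \<in> {-1..b+1} \<rightarrow>\<^sub>E UNIV" "y \<in> {-1..b+1} \<rightarrow>\<^sub>E UNIV"
      using x y by (simp_all add: ivp_solution_def)
    fix n
    assume n: "n \<in> {-1..b+1}"
    then consider "n = -1" | "n \<in> {0..b}" | "n = b + 1"
      by fastforce
    then show "x n = y n"
      using backward forward[of n] forward[of b] \<open>b \<ge> 0\<close> by cases auto
  qed
qed

text \<open>
  With \<open>r r' = 1\<close> the operator \<open>x (n + 1) - (r + r') x n + x (n - 1)\<close> equals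
  \<open>w n - r' w (n - 1)\<close> for \<open>w n = x (n + 1) - r x n\<close>. The integrating factor \<open>r ^ n\<close> absorbs
  \<open>r'\<close>, so \<open>r ^ n w n\<close> changes by exactly \<open>- r ^ n f n\<close> in each step. The constant is its value at
  \<open>n = -1\<close>.
\<close>

lemma factored_recurrence_telescopes:
  fixes r r' :: "'a::field" and x f :: "int \<Rightarrow> 'a"
  assumes inv: "r * r' = 1"
    and rec: "\<And>n. n \<in> {0..b} \<Longrightarrow> x (n + 1) - (r + r') * x n + x (n - 1) = - f n"
    and "-1 \<le> n" "n \<le> b"
  shows "r powi n * (x (n + 1) - r * x n) = r' * x 0 - x (-1) - (\<Sum>i\<in>{0..n}. r powi i * f i)"
  using \<open>-1 \<le> n\<close> \<open>n \<le> b\<close>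
proof (induction n rule: int_ge_induct)
  case base
  have "r powi (-1) = r'"
    using inverse_unique[OF inv] by (simp add: power_int_minus)
  moreover have "r' * (x 0 - r * x (-1)) = r' * x 0 - r * r' * x (-1)"
    by (simp add: algebra_simps)
  ultimately show ?case
    using inv by simp
next
  case (step n)
  have "r \<noteq> 0"
    using inv by auto
  then have pow: "r powi (n + 1) = r powi n * r"
    by (simp add: power_int_add)
  have w: "x (n + 1 + 1) - r * x (n + 1) = r' * x (n + 1) - x n - f (n + 1)"
    using rec[of "n + 1"] step by (simp add: algebra_simps add_eq_0_iff)
  have "r powi (n + 1) * (x (n + 1 + 1) - r * x (n + 1)) =
      r powi n * (r * r' * x (n + 1) - r * x n) - r powi (n + 1) * f (n + 1)"
    unfolding w pow by (simp add: algebra_simps)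
  also have "\<dots> = r powi n * (x (n + 1) - r * x n) - r powi (n + 1) * f (n + 1)"
    using inv by simp
  also have "\<dots> = r' * x 0 - x (-1) - (\<Sum>i\<in>{0..n}. r powi i * f i) - r powi (n + 1) * f (n + 1)"
    using step by simp
  also have "\<dots> = r' * x 0 - x (-1) - (\<Sum>i\<in>{0..n+1}. r powi i * f i)"
  proof -
    have "{0..n+1} = insert (n + 1) {0..n}"
      using step by auto
    then show ?thesis
      by simp
  qed
  finally show ?case .
qed

text \<open>
  Variation of constants: the two telescoped identities, one for each root, are multiplied by the
  inverse powers and subtracted, which eliminates \<open>x (n + 1)\<close>.
\<close>

lemma variation_of_constants:
  fixes p m :: "'a::field" and x f :: "int \<Rightarrow> 'a"
  assumes inv: "p * m = 1"
    and rec: "\<And>n. n \<in> {0..b} \<Longrightarrow> x (n + 1) - (p + m) * x n + x (n - 1) = - f n"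
    and n: "-1 \<le> n" "n \<le> b"
  shows "(p - m) * x n =
      (p * x 0 - x (-1) - (\<Sum>i\<in>{0..n}. m powi i * f i)) * p powi n
    - (m * x 0 - x (-1) - (\<Sum>i\<in>{0..n}. p powi i * f i)) * m powi n"
proof -
  have P: "p powi n * (x (n + 1) - p * x n) = m * x 0 - x (-1) - (\<Sum>i\<in>{0..n}. p powi i * f i)"
    using inv rec n by (rule factored_recurrence_telescopes)
  have M: "m powi n * (x (n + 1) - m * x n) = p * x 0 - x (-1) - (\<Sum>i\<in>{0..n}. m powi i * f i)"
  proof (rule factored_recurrence_telescopes)
    show "m * p = 1"
      using inv by (simp add: mult.commute)
    show "x (k + 1) - (m + p) * x k + x (k - 1) = - f k" if "k \<in> {0..b}" for k
      using rec[OF that] by (simp add: add.commute)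
  qed (use n in auto)
  have pw: "p powi n * m powi n = 1"
    using inv by (simp flip: power_int_mult_distrib)
  have "m powi n * (x (n + 1) - m * x n) * p powi n - p powi n * (x (n + 1) - p * x n) * m powi n
      = p powi n * m powi n * ((p - m) * x n)"
    by (simp add: algebra_simps)
  then show ?thesis
    unfolding P M pw by simp
qed

theorem theorem3p1:
  fixes b :: int and q :: "int \<Rightarrow> real" and h :: real and lam s :: complex
  assumes "b \<ge> 1"
    and "lam * (lam - 4) \<noteq> 0"
    and "s\<^sup>2 = lam * (lam - 4)"
  shows "(\<exists>!x. ivp_solution b q h lam x) \<and>
    (\<forall>x. ivp_solution b q h lam x \<longrightarrow>
      (\<forall>n\<in>{-1..b}.
        x n =
          (2 - of_real h * (2 * of_real (q 0) - 2 + lam + s)) / (2 * s)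
            * ((2 - lam + s) / 2) powi n
        + (- 2 + of_real h * (2 * of_real (q 0) - 2 + lam - s)) / (2 * s)
            * ((2 - lam - s) / 2) powi n
        - (\<Sum>i\<in>{0..n}. of_real (q i) * x i * ((2 - lam - s) / 2) powi i / s)
            * ((2 - lam + s) / 2) powi n
        + (\<Sum>i\<in>{0..n}. of_real (q i) * x i * ((2 - lam + s) / 2) powi i / s)
            * ((2 - lam - s) / 2) powi n))"
proof -
  have s: "s \<noteq> 0"
    using assms(2,3) by auto
  define p where "p = (2 - lam + s) / 2"
  define m where "m = (2 - lam - s) / 2"
  have sum: "p + m = 2 - lam" and diff: "p - m = s"
    by (simp_all add: p_def m_def field_simps)
  have "p * m = ((2 - lam)\<^sup>2 - s\<^sup>2) / 4"
    by (simp add: p_def m_def power2_eq_square algebra_simps)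
  also have "(2 - lam)\<^sup>2 - s\<^sup>2 = 4"
    unfolding assms(3) by (simp add: power2_eq_square algebra_simps)
  finally have inv: "p * m = 1"
    by simp
  have repr: "x n =
        (2 - of_real h * (2 * of_real (q 0) - 2 + lam + s)) / (2 * s) * p powi n
      + (- 2 + of_real h * (2 * of_real (q 0) - 2 + lam - s)) / (2 * s) * m powi n
      - (\<Sum>i\<in>{0..n}. of_real (q i) * x i * m powi i / s) * p powi n
      + (\<Sum>i\<in>{0..n}. of_real (q i) * x i * p powi i / s) * m powi n"
    (is "_ = ?rhs") if x: "ivp_solution b q h lam x" and n: "n \<in> {-1..b}" for x n
  proof -
    have rec: "x (k + 1) - (p + m) * x k + x (k - 1) = - (of_real (q k) * x k)"
      if "k \<in> {0..b}" for k
      using x that by (simp add: ivp_solution_iff_recurrence sum)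
    have x0: "x 0 = - of_real h" and x1: "x 1 = 1"
      using x by (simp_all add: ivp_solution_def)
    have xm1: "x (-1) = - of_real h * (p + m) + of_real h * of_real (q 0) - 1"
      using rec[of 0] assms(1) x0 x1 by (simp add: algebra_simps add_eq_0_iff)
    have voc: "s * x n =
        (p * x 0 - x (-1) - (\<Sum>i\<in>{0..n}. m powi i * (of_real (q i) * x i))) * p powi n
      - (m * x 0 - x (-1) - (\<Sum>i\<in>{0..n}. p powi i * (of_real (q i) * x i))) * m powi n"
      using variation_of_constants[OF inv rec, of b n] n diff by simp
    have A: "p * x 0 - x (-1) = (2 - of_real h * (2 * of_real (q 0) - 2 + lam + s)) / 2"
      by (simp add: x0 xm1 p_def m_def field_simps)
    have B: "m * x 0 - x (-1) = - ((- 2 + of_real h * (2 * of_real (q 0) - 2 + lam - s)) / 2)"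
      by (simp add: x0 xm1 p_def m_def field_simps)
    have sums: "(\<Sum>i\<in>{0..n}. of_real (q i) * x i * r powi i / s)
        = (\<Sum>i\<in>{0..n}. r powi i * (of_real (q i) * x i)) / s" for r
      by (simp add: sum_divide_distrib mult_ac)
    have divide: "((a / 2 - S) * P - (- (c / 2) - T) * M) / s =
        a / (2 * s) * P + c / (2 * s) * M - S / s * P + T / s * M" for a c S T P M
      using s by (simp add: field_simps)
    have "x n = (s * x n) / s"
      using s by simp
    also have "\<dots> = ?rhs"
      unfolding voc A B sums by (rule divide)
    finally show ?thesis .
  qed
  have "\<exists>!x. ivp_solution b q h lam x"
    using ivp_solution_exists[of b] ivp_solution_unique[of b] assms(1) by (auto intro!: ex_ex1I)
  then show ?thesis
    using repr unfolding p_def m_def by blast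
qed

end
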